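(* Let $G$ be a finite simple connected graph, let $\ell \ge 1$, and let $H$ be a retract of $G$. Then $c_\ell(H) \le c_\ell(G)$ and $c'_\ell(H) \le c'_\ell(G)$.
   Context: $\ell$-visibility Cops and Robber on a graph $G$: in round 0 a set of cops each choose a vertex, then a single robber chooses a vertex. In each subsequent round, every cop moves to a neighbouring vertex or stays put, and then the robber moves to a neighbouring vertex or stays put. The robber always knows the positions of all cops. The cops know the robber's position only at moments when some cop and the robber occupy vertices $x,y$ with $d(x,y)\le \ell$ (the cops then "see" the robber and share this information). The cops capture the robber if a cop occupies the robber's vertex. $c_\ell(G)$ is the minimum number of cops that can guarantee capture, and $c'_\ell(G)$ is the minimum number of cops that can guarantee that at some moment some cop is within distance $\ell$ of the robber. A subgraph $H$ of $G$ is a retract if there is a graph homomorphism $f:V(G)\to V(H)$ (of reflexive graphs, i.e. adjacent vertices map to adjacent or equal vertices) with $f(v)=v$ for all $v\in V(H)$. *)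

theory Defs
  imports "Graph_Theory.Graph_Theory"
begin

text \<open>A simple graph is a \<^const>\<open>pair_graph\<close>: each edge is represented by its two opposite arcs,
  and there are no loops. With unit weights, the shortest-path weight is the graph distance
  (\<open>\<infinity>\<close> between different components).\<close>

definition graph_dist :: "'a pair_pre_digraph \<Rightarrow> 'a \<Rightarrow> 'a \<Rightarrow> ereal" where
  "graph_dist G u v = wf_digraph.\<mu> (with_proj G) (\<lambda>_. 1) u v"

definition retract_of :: "'a pair_pre_digraph \<Rightarrow> 'a pair_pre_digraph \<Rightarrow> bool" where
  "retract_of H G \<longleftrightarrow> pair_graph H \<and> subgraph (with_proj H) (with_proj G) \<and>
     (\<exists>f \<in> pverts G \<rightarrow> pverts H.
        (\<forall>(u, v) \<in> parcs G. f u = f v \<or> (f u, f v) \<in> parcs H) \<and>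
        (\<forall>v \<in> pverts H. f v = v))"

text \<open>A configuration of \<open>k\<close> cops is a function \<open>c\<close>, of which only the values \<open>c i\<close> for \<open>i < k\<close>
  matter; several cops may share a vertex.\<close>

definition caught :: "nat \<Rightarrow> (nat \<Rightarrow> 'a) \<Rightarrow> 'a \<Rightarrow> bool" where
  "caught k c x \<longleftrightarrow> (\<exists>i<k. c i = x)"

definition seen :: "'a pair_pre_digraph \<Rightarrow> nat \<Rightarrow> nat \<Rightarrow> (nat \<Rightarrow> 'a) \<Rightarrow> 'a \<Rightarrow> bool" where
  "seen G l k c x \<longleftrightarrow> (\<exists>i<k. graph_dist G (c i) x \<le> ereal (real l))"

definition observation ::
    "'a pair_pre_digraph \<Rightarrow> nat \<Rightarrow> nat \<Rightarrow> (nat \<Rightarrow> 'a) \<Rightarrow> 'a \<Rightarrow> 'a option" where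
  "observation G l k c x = (if seen G l k c x then Some x else None)"

text \<open>A cop strategy \<open>\<sigma>\<close> maps the list of observations made so far to the next configuration of the
  cops. Here \<open>r t\<close> is the position of the robber at the end of round \<open>t\<close>, and \<open>history\<close> is the list
  of observations available when the cops choose their configuration of round \<open>t\<close>. There is one
  observation in round 0, after the robber's placement. In every later round there are two:
  one between the cops' move and the robber's move, and one after the robber's move. The cops' own
  earlier positions need not be recorded, since \<open>\<sigma>\<close> and the observations determine them.\<close>

fun history :: "'a pair_pre_digraph \<Rightarrow> nat \<Rightarrow> nat \<Rightarrow> ('a option list \<Rightarrow> nat \<Rightarrow> 'a) \<Rightarrow> (nat \<Rightarrow> 'a)
    \<Rightarrow> nat \<Rightarrow> 'a option list" where
  "history G l k \<sigma> r 0 = []"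
| "history G l k \<sigma> r (Suc 0) = [observation G l k (\<sigma> []) (r 0)]"
| "history G l k \<sigma> r (Suc (Suc t)) =
     (let h = history G l k \<sigma> r (Suc t)
      in h @ [observation G l k (\<sigma> h) (r t), observation G l k (\<sigma> h) (r (Suc t))])"

definition cops_at :: "'a pair_pre_digraph \<Rightarrow> nat \<Rightarrow> nat \<Rightarrow> ('a option list \<Rightarrow> nat \<Rightarrow> 'a) \<Rightarrow>
    (nat \<Rightarrow> 'a) \<Rightarrow> nat \<Rightarrow> nat \<Rightarrow> 'a" where
  "cops_at G l k \<sigma> r t = \<sigma> (history G l k \<sigma> r t)"

definition legal_moves :: "'a pair_pre_digraph \<Rightarrow> (nat \<Rightarrow> 'a) \<Rightarrow> bool" where
  "legal_moves G p \<longleftrightarrow>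
     (\<forall>t. p t \<in> pverts G \<and> (p (Suc t) = p t \<or> (p t, p (Suc t)) \<in> parcs G))"

text \<open>\<open>k\<close> cops can guarantee that \<open>P\<close> holds at some moment. The strategy \<open>\<sigma>\<close> is fixed first and then
  faces every legal trajectory of the robber; these are exactly the trajectories that a robber with
  full information can produce against \<open>\<sigma>\<close>. The two disjuncts are the moments after the robber's
  move in round \<open>t\<close> and after the cops' move in round \<open>t + 1\<close>.\<close>

definition cops_guarantee ::
    "'a pair_pre_digraph \<Rightarrow> nat \<Rightarrow> nat \<Rightarrow> ((nat \<Rightarrow> 'a) \<Rightarrow> 'a \<Rightarrow> bool) \<Rightarrow> bool" where
  "cops_guarantee G l k P \<longleftrightarrow>
     (\<exists>\<sigma>. \<forall>r. legal_moves G r \<longrightarrow>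
        (\<forall>i<k. legal_moves G (\<lambda>t. cops_at G l k \<sigma> r t i)) \<and>
        (\<exists>t. P (cops_at G l k \<sigma> r t) (r t) \<or> P (cops_at G l k \<sigma> r (Suc t)) (r t)))"

definition cop_number :: "nat \<Rightarrow> 'a pair_pre_digraph \<Rightarrow> nat" where
  "cop_number l G = (LEAST k. cops_guarantee G l k (caught k))"

definition seeing_number :: "nat \<Rightarrow> 'a pair_pre_digraph \<Rightarrow> nat" where
  "seeing_number l G = (LEAST k. cops_guarantee G l k (seen G l k))"

end

theory Submission
  imports Defs
begin

text \<open>The cops on \<open>H\<close> imagine a game on \<open>G\<close> in which they follow a winning strategy for \<open>G\<close>, and they
  occupy the images of their imagined positions under the retraction. A retraction fixes the robber's
  vertex and does not increase distances, so whenever an imagined cop sees the robber, the real one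
  does too: the cops can reconstruct every imagined observation from a real one.\<close>

text \<open>Turns distance bounds into walks, which a graph map can act on: with unit weights
  \<open>graph_dist\<close> is an infimum of walk lengths.\<close>

lemma graph_dist_le_iff:
  assumes "pair_graph G"
  shows "graph_dist G u v \<le> ereal (real l) \<longleftrightarrow>
    (\<exists>p. pre_digraph.awalk (with_proj G) u p v \<and> length p \<le> l)"
proof -
  interpret pair_graph G by fact
  have cost: "awalk_cost (\<lambda>_. 1) p = real (length p)" for p :: "('a \<times> 'a) list"
    by (induction p) simp_all
  show ?thesis
  proof
    assume "graph_dist G u v \<le> ereal (real l)"
    \<comment> \<open>Only a strict bound on an infimum yields a witness; as lengths are integers, a
      walk shorter than \<open>Suc l\<close> has length at most \<open>l\<close>.\<close>
    then have "graph_dist G u v < ereal (real (Suc l))"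
      by (rule le_less_trans) simp
    then show "\<exists>p. awalk u p v \<and> length p \<le> l"
      unfolding graph_dist_def \<mu>_def INF_less_iff by (auto simp: cost)
  next
    assume "\<exists>p. awalk u p v \<and> length p \<le> l"
    then obtain p where p: "awalk u p v" "length p \<le> l" by blast
    have "graph_dist G u v \<le> ereal (awalk_cost (\<lambda>_. 1) p)"
      unfolding graph_dist_def by (rule min_cost_le_walk_cost) fact
    also have "\<dots> \<le> ereal (real l)"
      using p by (simp add: cost)
    finally show "graph_dist G u v \<le> ereal (real l)" .
  qed
qed

text \<open>Names the condition on the witness in \<open>retract_of\<close>, so that a single map
  can be fixed throughout.\<close>

definition graph_retraction ::
    "'a pair_pre_digraph \<Rightarrow> 'a pair_pre_digraph \<Rightarrow> ('a \<Rightarrow> 'a) \<Rightarrow> bool" where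
  "graph_retraction G H f \<longleftrightarrow> f \<in> pverts G \<rightarrow> pverts H \<and>
     (\<forall>(u, v) \<in> parcs G. f u = f v \<or> (f u, f v) \<in> parcs H) \<and> (\<forall>v \<in> pverts H. f v = v)"

text \<open>Arcs collapsed by \<open>f\<close> are dropped and all others go to arcs of
  \<open>H\<close>, so the image walk cannot be longer.\<close>

lemma awalk_retraction:
  assumes "pair_graph G" "pair_graph H" and f: "graph_retraction G H f"
    and "pre_digraph.awalk (with_proj G) u p v"
  shows "\<exists>q. pre_digraph.awalk (with_proj H) (f u) q (f v) \<and> length q \<le> length p"
proof -
  interpret G: pair_graph G by fact
  interpret H: pair_graph H by fact
  show ?thesis
    using assms(4)
  proof (induction p arbitrary: u)
    case Nil
    then have "H.awalk (f u) [] (f v)"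
      using f by (auto simp: G.awalk_Nil_iff H.awalk_Nil_iff graph_retraction_def)
    then show ?case by auto
  next
    case (Cons e p)
    then obtain w where e: "e = (u, w)" "e \<in> parcs G" and "G.awalk w p v"
      by (cases e) (auto simp: G.awalk_Cons_iff)
    with Cons.IH obtain q where q: "H.awalk (f w) q (f v)" "length q \<le> length p" by blast
    from f e have "f u = f w \<or> (f u, f w) \<in> parcs H"
      by (auto simp: graph_retraction_def)
    then show ?case
    proof
      assume "f u = f w"
      with q show ?thesis by (auto intro!: exI[of _ q])
    next
      assume "(f u, f w) \<in> parcs H"
      with q have "H.awalk (f u) ((f u, f w) # q) (f v)"
        by (auto simp: H.awalk_Cons_iff)
      with q show ?thesis by (auto intro!: exI[of _ "(f u, f w) # q"])
    qed
  qed
qed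

lemma seen_retraction:
  assumes "pair_graph G" "pair_graph H" "graph_retraction G H f" "x \<in> pverts H"
    and "seen G l k c x"
  shows "seen H l k (f \<circ> c) x"
proof -
  from assms(3,4) have "f x = x"
    by (auto simp: graph_retraction_def)
  with assms show ?thesis
    unfolding seen_def graph_dist_le_iff[OF assms(1)] graph_dist_le_iff[OF assms(2)]
    by (metis awalk_retraction comp_apply le_trans)
qed

lemma caught_retraction:
  assumes "graph_retraction G H f" "x \<in> pverts H" "caught k c x"
  shows "caught k (f \<circ> c) x"
  using assms by (auto simp: caught_def graph_retraction_def)

text \<open>The list of real observations is given in reverse, latest first; the two observations of a round
  are imagined with the same cop configuration.\<close>

fun imagined ::
    "('b \<Rightarrow> 'a option \<Rightarrow> 'a option) \<Rightarrow> ('a option list \<Rightarrow> 'b) \<Rightarrow> 'a option list \<Rightarrow> 'a option list" where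
  "imagined g \<sigma> [] = []"
| "imagined g \<sigma> [a] = [g (\<sigma> []) a]"
| "imagined g \<sigma> (b # a # h) =
     (let h' = imagined g \<sigma> h in h' @ [g (\<sigma> h') a, g (\<sigma> h') b])"

text \<open>A real sighting is tested again from the imagined cops on \<open>G\<close>, which may be
  too far away to share it; a real \<open>None\<close> stays \<open>None\<close>. The
  \<open>rev\<close> is there because \<open>history\<close> appends while \<open>imagined\<close>
  peels off the latest entries.\<close>

definition pulled_back_strategy :: "'a pair_pre_digraph \<Rightarrow> nat \<Rightarrow> nat \<Rightarrow> ('a \<Rightarrow> 'a) \<Rightarrow>
    ('a option list \<Rightarrow> nat \<Rightarrow> 'a) \<Rightarrow> 'a option list \<Rightarrow> nat \<Rightarrow> 'a" where
  "pulled_back_strategy G l k f \<sigma> h =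
     f \<circ> \<sigma> (imagined (\<lambda>c a. Option.bind a (observation G l k c)) \<sigma> (rev h))"

text \<open>Strategy and history depend on each other, hence induction on rounds: once the imagined
  past is correct, the real cops stand at the \<open>f\<close>-images of the imagined ones, and the
  next observations are recovered too.\<close>

lemma imagined_history:
  assumes "pair_graph G" "pair_graph H" "graph_retraction G H f" and r: "\<And>t. r t \<in> pverts H"
  shows "imagined (\<lambda>c a. Option.bind a (observation G l k c)) \<sigma>
      (rev (history H l k (pulled_back_strategy G l k f \<sigma>) r t)) = history G l k \<sigma> r t"
proof -
  \<comment> \<open>If the real cops see nothing, neither do the imagined ones; otherwise the
    robber's vertex is known and the imagined observation can be computed.\<close>
  have obs: "Option.bind (observation H l k (f \<circ> c) (r t)) (observation G l k c)
      = observation G l k c (r t)" for c t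
    using seen_retraction[OF assms(1-3) r] by (auto simp: observation_def)
  show ?thesis
  proof (induction t)
    case (Suc t)
    then show ?case
      \<comment> \<open>The split separates round 0, with its single observation, from later rounds
        with two.\<close>
      by (cases t) (simp_all add: Let_def obs[unfolded comp_def] comp_def pulled_back_strategy_def)
  qed simp
qed

lemma cops_at_pulled_back:
  assumes "pair_graph G" "pair_graph H" "graph_retraction G H f" "\<And>t. r t \<in> pverts H"
  shows "cops_at H l k (pulled_back_strategy G l k f \<sigma>) r t = f \<circ> cops_at G l k \<sigma> r t"
  by (simp add: cops_at_def pulled_back_strategy_def comp_def imagined_history[OF assms])

lemma legal_moves_retraction:
  assumes "graph_retraction G H f" "legal_moves G p"
  shows "legal_moves H (\<lambda>t. f (p t))"
  unfolding legal_moves_def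
proof (intro allI conjI)
  fix t
  from assms show "f (p t) \<in> pverts H"
    by (auto simp: legal_moves_def graph_retraction_def)
  from assms(2) have "p (Suc t) = p t \<or> (p t, p (Suc t)) \<in> parcs G"
    by (auto simp: legal_moves_def)
  with assms(1) show "f (p (Suc t)) = f (p t) \<or> (f (p t), f (p (Suc t))) \<in> parcs H"
    by (fastforce simp: graph_retraction_def)
qed

text \<open>Lets a strategy for \<open>G\<close> be played against a robber confined to
  \<open>H\<close>.\<close>

lemma legal_moves_subgraph:
  assumes "subgraph (with_proj H) (with_proj G)" "legal_moves H p"
  shows "legal_moves G p"
proof -
  from assms(1) have "pverts H \<subseteq> pverts G" "parcs H \<subseteq> parcs G"
    by (auto simp: subgraph_def)
  with assms(2) show ?thesis
    unfolding legal_moves_def by blast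
qed

text \<open>\<open>P\<close> and \<open>Q\<close> are kept abstract so that capture and sighting are
  both instances.\<close>

lemma cops_guarantee_retraction:
  assumes "pair_graph G" "pair_graph H" "subgraph (with_proj H) (with_proj G)"
    and f: "graph_retraction G H f"
    and P: "\<And>c x. x \<in> pverts H \<Longrightarrow> P c x \<Longrightarrow> Q (f \<circ> c) x"
    and "cops_guarantee G l k P"
  shows "cops_guarantee H l k Q"
proof -
  from assms(6) obtain \<sigma> where \<sigma>: "\<And>r. legal_moves G r \<Longrightarrow>
      (\<forall>i<k. legal_moves G (\<lambda>t. cops_at G l k \<sigma> r t i)) \<and>
      (\<exists>t. P (cops_at G l k \<sigma> r t) (r t) \<or> P (cops_at G l k \<sigma> r (Suc t)) (r t))"
    unfolding cops_guarantee_def by blast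
  let ?\<tau> = "pulled_back_strategy G l k f \<sigma>"
  have "(\<forall>i<k. legal_moves H (\<lambda>t. cops_at H l k ?\<tau> r t i)) \<and>
      (\<exists>t. Q (cops_at H l k ?\<tau> r t) (r t) \<or> Q (cops_at H l k ?\<tau> r (Suc t)) (r t))"
    if "legal_moves H r" for r
  proof -
    from that have r: "r t \<in> pverts H" for t
      by (simp add: legal_moves_def)
    have "cops_at H l k ?\<tau> r t = f \<circ> cops_at G l k \<sigma> r t" for t
      by (rule cops_at_pulled_back[OF assms(1,2) f r])
    \<comment> \<open>Positions correspond in every round, so success at either kind of moment
      carries over.\<close>
    with \<sigma>[OF legal_moves_subgraph[OF assms(3) that]] show ?thesis
      using legal_moves_retraction[OF f] P[OF r] by (simp add: comp_def) blast
  qed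
  then show ?thesis
    unfolding cops_guarantee_def by blast
qed

text \<open>One motionless cop on each vertex catches the robber at its placement. This shows that
  the minima for \<open>G\<close> are attained.\<close>

lemma cops_guarantee_card_pverts:
  assumes "pair_graph G"
    and P: "\<And>c x. x \<in> pverts G \<Longrightarrow> caught (card (pverts G)) c x \<Longrightarrow> P c x"
  shows "cops_guarantee G l (card (pverts G)) P"
proof -
  interpret pair_graph G by fact
  obtain c where c: "bij_betw c {0..<card (pverts G)} (pverts G)"
    using ex_bij_betw_nat_finite[of "pverts G"] finite_verts by auto
  let ?\<sigma> = "\<lambda>_ :: 'a option list. c"
  have "\<forall>i<card (pverts G). legal_moves G (\<lambda>t. c i)"
    using c by (auto simp: legal_moves_def bij_betw_def)
  moreover have "P c (r 0)" if "legal_moves G r" for r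
  proof (rule P)
    from that show "r 0 \<in> pverts G"
      by (simp add: legal_moves_def)
    with c have "r 0 \<in> c ` {0..<card (pverts G)}"
      by (simp add: bij_betw_def)
    then show "caught (card (pverts G)) c (r 0)"
      by (auto simp: caught_def)
  qed
  ultimately show ?thesis
    unfolding cops_guarantee_def cops_at_def by (intro exI[of _ ?\<sigma>]) blast
qed

lemma caught_imp_seen:
  assumes "pair_graph G" "x \<in> pverts G" "caught k c x"
  shows "seen G l k c x"
proof -
  interpret pair_graph G by fact
  have "awalk x [] x"
    using assms(2) by (simp add: awalk_Nil_iff)
  then have "graph_dist G x x \<le> ereal (real l)"
    unfolding graph_dist_le_iff[OF assms(1)] by fastforce
  with assms(3) show ?thesis
    by (auto simp: caught_def seen_def)
qed

theorem theorem2p1: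
  fixes G H :: "'a pair_pre_digraph" and l :: nat
  assumes "pair_graph G" and "Digraph_Component.connected (with_proj G)"
    and "l \<ge> 1"
    and "retract_of H G"
  shows "cop_number l H \<le> cop_number l G \<and> seeing_number l H \<le> seeing_number l G"
proof
  from assms(4) obtain f where H: "pair_graph H" "subgraph (with_proj H) (with_proj G)"
    and f: "graph_retraction G H f"
    unfolding retract_of_def graph_retraction_def by blast
  \<comment> \<open>\<open>LEAST\<close> satisfies its predicate only if some number does;
    \<open>card (pverts G)\<close> is the witness.\<close>
  have "cops_guarantee G l (cop_number l G) (caught (cop_number l G))"
    unfolding cop_number_def
    by (rule LeastI[where P = "\<lambda>k. cops_guarantee G l k (caught k)"],
        rule cops_guarantee_card_pverts[OF assms(1)])
  then have "cops_guarantee H l (cop_number l G) (caught (cop_number l G))"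
    by (rule cops_guarantee_retraction[OF assms(1) H f, rotated]) (rule caught_retraction[OF f])
  then show "cop_number l H \<le> cop_number l G"
    unfolding cop_number_def[of l H] by (rule Least_le)
  have "cops_guarantee G l (seeing_number l G) (seen G l (seeing_number l G))"
    unfolding seeing_number_def
    by (rule LeastI[where P = "\<lambda>k. cops_guarantee G l k (seen G l k)"],
        rule cops_guarantee_card_pverts[OF assms(1) caught_imp_seen[OF assms(1)]])
  then have "cops_guarantee H l (seeing_number l G) (seen H l (seeing_number l G))"
    by (rule cops_guarantee_retraction[OF assms(1) H f, rotated])
       (rule seen_retraction[OF assms(1) H(1) f])
  then show "seeing_number l H \<le> seeing_number l G"
    unfolding seeing_number_def[of l H] by (rule Least_le)
qed

end
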